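(* Let $\mathcal{H}$ be a separable complex Hilbert space, let $N\geq 2$ be an integer, and let $T_1,\dots,T_N$ be bounded linear operators on $\mathcal{H}$. Let $(\alpha_{ij})_{1\leq i,j\leq N}$ be a symmetric matrix with entries $\alpha_{ij}\in[0,1]$ such that for all $i,j\in\{1,\dots,N\}$ $$\|T_iT_j^{*}\|_{\infty}\leq \alpha_{ij}^{2}\,\|T_i\|_{\infty}\|T_j\|_{\infty}\quad\text{and}\quad \|T_i^{*}T_j\|_{\infty}\leq \alpha_{ij}^{2}\,\|T_i\|_{\infty}\|T_j\|_{\infty}.$$ Then $$\Bigl\|\sum_{j=1}^N T_j\Bigr\|_{\infty}\leq \bigl\|(\alpha_{ij})\bigr\|_{2}\,\sup_{1\leq j\leq N}\|T_j\|_{\infty},$$ where $\|(\alpha_{ij})\|_{2}$ is the operator norm of the matrix $(\alpha_{ij})$ on $\ell_2^N\to\ell_2^N$.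
   Context: $\|T\|_\infty$ denotes the usual operator norm of a bounded linear operator $T$ on $\mathcal{H}$. *)

theory Defs
  imports "HOL-Analysis.Analysis"
begin

class complex_vector = real_vector +
  fixes scaleC :: "complex \<Rightarrow> 'a \<Rightarrow> 'a"  (infixr \<open>*\<^sub>C\<close> 75)
  assumes scaleC_add_right: "a *\<^sub>C (x + y) = a *\<^sub>C x + a *\<^sub>C y"
    and scaleC_add_left: "(a + b) *\<^sub>C x = a *\<^sub>C x + b *\<^sub>C x"
    and scaleC_scaleC: "a *\<^sub>C (b *\<^sub>C x) = (a * b) *\<^sub>C x"
    and scaleC_one: "1 *\<^sub>C x = x"
    and scaleR_eq_scaleC: "r *\<^sub>R x = complex_of_real r *\<^sub>C x"

(* cinner is linear in its first and conjugate-linear in its second argument.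
   Positive definiteness follows from power2_norm_eq_cinner, which says that the norm is the
   one induced by cinner.  The norm axioms inherited from real_normed_vector are consequences
   of the inner product axioms; they are inherited so that bounded_linear and onorm apply. *)
class complex_inner = complex_vector + real_normed_vector +
  fixes cinner :: "'a \<Rightarrow> 'a \<Rightarrow> complex"
  assumes cinner_commute: "cinner x y = cnj (cinner y x)"
    and cinner_add_left: "cinner (x + y) z = cinner x z + cinner y z"
    and cinner_scaleC_left: "cinner (a *\<^sub>C x) y = a * cinner x y"
    and power2_norm_eq_cinner: "complex_of_real ((norm x)\<^sup>2) = cinner x x"

class chilbert_space = complex_inner + complete_space

definition bounded_clinear :: "('a::complex_inner \<Rightarrow> 'b::complex_inner) \<Rightarrow> bool"
  where "bounded_clinear f \<longleftrightarrow> bounded_linear f \<and> (\<forall>c x. f (c *\<^sub>C x) = c *\<^sub>C f x)"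

(* Same pattern as the library's adjoint for real inner products.  For a bounded operator
   between Hilbert spaces such a g exists by the Riesz representation theorem, and it is unique. *)
definition cadjoint :: "('a::chilbert_space \<Rightarrow> 'b::chilbert_space) \<Rightarrow> 'b \<Rightarrow> 'a"
  where "cadjoint f = (SOME g. \<forall>x y. cinner (f x) y = cinner x (g y))"

end

theory Submission
  imports Defs
begin

text \<open>Put \<open>S = \<Sum>\<^sub>j T\<^sub>j\<close> and \<open>P = S\<^sup>* S\<close>. Since \<open>P\<close> is self-adjoint,
  \<open>\<parallel>S\<parallel>\<^bsup>2n\<^esup> \<le> \<parallel>P\<^bsup>n\<^esup>\<parallel>\<close> when \<open>n\<close> is a power of two. Expand \<open>P\<^bsup>n\<^esup>\<close> into alternating words
  \<open>T\<^sub>i\<^sup>* T\<^sub>j T\<^sub>k\<^sup>* T\<^sub>l \<dots>\<close>. Grouping the letters of a word in pairs, from the first or from the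
  second letter on, gives two bounds for its norm; their geometric mean is at most
  \<open>(sup \<parallel>T\<^sub>j\<parallel>)\<^bsup>2n\<^esup>\<close> times the product of the \<open>\<alpha>\<close>s along the word. The sum of these products is
  a sum of entries of \<open>\<alpha>\<^bsup>2n-1\<^esup>\<close>, hence at most a constant times \<open>\<parallel>\<alpha>\<parallel>\<^bsup>2n-1\<^esup>\<close>.
  The constant disappears on taking \<open>2n\<close>-th roots as \<open>n\<close> tends to infinity.\<close>

section \<open>Complex inner products and adjoints\<close>

lemma cinner_add_right: "cinner x (y + z) = cinner x y + cinner x z"
  by (metis cinner_add_left cinner_commute complex_cnj_add)

lemma cinner_scaleR_left: "cinner (r *\<^sub>R x) y = of_real r * cinner x y"
  by (simp add: scaleR_eq_scaleC cinner_scaleC_left)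

lemma cinner_scaleR_right: "cinner x (r *\<^sub>R y) = of_real r * cinner x y"
  by (metis cinner_commute cinner_scaleR_left complex_cnj_complex_of_real complex_cnj_mult)

lemma cinner_zero_left [simp]: "cinner 0 x = 0"
  using cinner_scaleR_left[of 0 0 x] by simp

lemma cinner_zero_right [simp]: "cinner x 0 = 0"
  by (metis cinner_commute cinner_zero_left complex_cnj_zero)

lemma cinner_minus_right: "cinner x (- y) = - cinner x y"
  using cinner_scaleR_right[of x "-1" y] by simp

lemma cinner_sum_left: "cinner (sum f A) y = (\<Sum>i\<in>A. cinner (f i) y)"
  by (induction A rule: infinite_finite_induct) (auto simp: cinner_add_left)

lemma cinner_sum_right: "cinner y (sum f A) = (\<Sum>i\<in>A. cinner y (f i))"
  by (induction A rule: infinite_finite_induct) (auto simp: cinner_add_right)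

lemma power2_norm_eq_Re_cinner: "(norm x)\<^sup>2 = Re (cinner x x)"
  by (metis Re_complex_of_real power2_norm_eq_cinner)

lemma Re_cinner_commute: "Re (cinner x y) = Re (cinner y x)"
  by (subst cinner_commute) simp

lemma power2_norm_add:
  "(norm (x + y))\<^sup>2 = (norm x)\<^sup>2 + 2 * Re (cinner x y) + (norm y)\<^sup>2"
  using Re_cinner_commute[of x y]
  by (simp add: power2_norm_eq_Re_cinner cinner_add_left cinner_add_right)

text \<open>Cauchy-Schwarz comes out of the triangle inequality, an axiom of the class: square it
  and cancel the squared norms.\<close>

lemma Re_cinner_le_norm: "Re (cinner x y) \<le> norm x * norm y"
proof -
  have "(norm (x + y))\<^sup>2 \<le> (norm x + norm y)\<^sup>2"
    by (intro power_mono norm_triangle_ineq) auto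
  then show ?thesis
    by (simp add: power2_norm_add power2_sum)
qed

lemma abs_Re_cinner_le_norm: "\<bar>Re (cinner x y)\<bar> \<le> norm x * norm y"
  using Re_cinner_le_norm[of x y] Re_cinner_le_norm[of x "- y"] by (simp add: cinner_minus_right)

lemma bounded_linear_Re_cinner_left: "bounded_linear (\<lambda>x. Re (cinner x y))"
  by (rule bounded_linear_intro[where K = "norm y"])
     (auto simp: cinner_add_left cinner_scaleR_left abs_Re_cinner_le_norm)

section \<open>Riesz representation\<close>

lemma parallelogram_midpoint:
  fixes x y :: "'a::complex_inner"
  shows "(norm (x - y))\<^sup>2 = 2 * (norm x)\<^sup>2 + 2 * (norm y)\<^sup>2 - 4 * (norm ((1/2) *\<^sub>R (x + y)))\<^sup>2"
proof -
  have "(norm ((1/2) *\<^sub>R (x + y)))\<^sup>2 = (norm (x + y))\<^sup>2 / 4"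
    by (simp add: power_divide)
  then show ?thesis
    using power2_norm_add[of x y] power2_norm_add[of x "- y"] by (simp add: cinner_minus_right)
qed

text \<open>The representing vector minimises \<open>\<lambda>x. (norm x)\<^sup>2 - 2 * f x\<close>; by the parallelogram law
  every minimising sequence is Cauchy.\<close>

lemma real_riesz_representation:
  fixes f :: "'a::chilbert_space \<Rightarrow> real"
  assumes "bounded_linear f"
  obtains z where "\<And>x. f x = Re (cinner x z)"
proof -
  note add = linear_add[OF bounded_linear.linear[OF assms]]
  note scale = linear_scale[OF bounded_linear.linear[OF assms]]
  define J where "J x = (norm x)\<^sup>2 - 2 * f x" for x
  define m where "m = (INF x. J x)"
  \<comment> \<open>Completing the square: \<open>J x\<close> is at least
    \<open>(norm x - onorm f)^2 - (onorm f)^2\<close>.\<close>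
  have "- (onorm f)\<^sup>2 \<le> J x" for x
  proof -
    have "f x \<le> onorm f * norm x"
      using onorm[OF assms, of x] by simp
    moreover have "0 \<le> (norm x - onorm f)\<^sup>2" by simp
    ultimately show ?thesis
      unfolding J_def power2_diff by (simp add: mult.commute)
  qed
  then have bdd: "bdd_below (range J)"
    by (meson bdd_belowI2)
  then have m_le: "m \<le> J x" for x
    unfolding m_def by (simp add: cINF_lower)
  have "\<exists>x. J x < m + 1 / real (Suc n)" for n
  proof -
    have "(INF x. J x) < m + 1 / real (Suc n)"
      unfolding m_def[symmetric] by simp
    then show ?thesis
      by (subst (asm) cINF_less_iff) (use bdd in auto)
  qed
  then obtain X where X: "\<And>n. J (X n) < m + 1 / real (Suc n)"
    by metis
  \<comment> \<open>At the midpoint the linear terms of \<open>J\<close> cancel, so the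
    parallelogram law carries over from the squared norm to \<open>J\<close>.\<close>
  have dist_X: "(norm (x - y))\<^sup>2 \<le> 2 * J x + 2 * J y - 4 * m" for x y
  proof -
    have "(norm (x - y))\<^sup>2 = 2 * J x + 2 * J y - 4 * J ((1/2) *\<^sub>R (x + y))"
      unfolding parallelogram_midpoint J_def scale add by (simp add: field_simps)
    then show ?thesis
      using m_le[of "(1/2) *\<^sub>R (x + y)"] by simp
  qed
  have "Cauchy X"
  proof (rule metric_CauchyI)
    fix e :: real assume "e > 0"
    \<comment> \<open>Two points whose \<open>J\<close>-values exceed \<open>m\<close> by less than
      \<open>q\<close> have squared distance below \<open>4 * q\<close> by
      \<open>dist_X\<close>.\<close>
    define q where "q = e\<^sup>2 / 4"
    have "q > 0" and e2: "e\<^sup>2 = 4 * q"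
      using \<open>e > 0\<close> by (simp_all add: q_def)
    then obtain M where M: "1 / real (Suc M) < q"
      using nat_approx_posE by blast
    have small: "J (X k) < m + q" if "k \<ge> M" for k
    proof -
      have "1 / real (Suc k) \<le> 1 / real (Suc M)"
        using that by (simp add: frac_le)
      then show ?thesis using X[of k] M by linarith
    qed
    have "dist (X k) (X l) < e" if "k \<ge> M" "l \<ge> M" for k l
    proof -
      have "(norm (X k - X l))\<^sup>2 \<le> 2 * J (X k) + 2 * J (X l) - 4 * m"
        by (rule dist_X)
      also have "\<dots> < 4 * q"
        using small[OF that(1)] small[OF that(2)] by linarith
      finally have "(norm (X k - X l))\<^sup>2 < e\<^sup>2"
        unfolding e2 .
      then show ?thesis
        using \<open>e > 0\<close> by (metis dist_norm less_imp_le power2_less_imp_less)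
    qed
    then show "\<exists>M. \<forall>k\<ge>M. \<forall>l\<ge>M. dist (X k) (X l) < e" by blast
  qed
  then obtain z where z: "X \<longlonglongrightarrow> z"
    by (auto simp: Cauchy_convergent_iff convergent_def)
  have "(\<lambda>n. J (X n)) \<longlonglongrightarrow> J z"
    unfolding J_def by (intro tendsto_intros bounded_linear.tendsto[OF assms] z)
  moreover have "(\<lambda>n. m + 1 / real (Suc n)) \<longlonglongrightarrow> m"
    using tendsto_add[OF tendsto_const LIMSEQ_Suc[OF lim_1_over_n], of m] by simp
  ultimately have "J z \<le> m"
    by (rule LIMSEQ_le) (use X less_imp_le in blast)
  then have J_min: "J z \<le> J x" for x
    using m_le order_trans by blast
  have "f h = Re (cinner h z)" for h
  proof (rule ccontr)
    define d where "d = f h - Re (cinner h z)"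
    \<comment> \<open>Up to the summand 1, which covers \<open>h = 0\<close>, this minimises
      \<open>J\<close> on the line through \<open>z\<close> in direction \<open>h\<close>. It makes
      \<open>J\<close> smaller than at \<open>z\<close>.\<close>
    define t where "t = d / ((norm h)\<^sup>2 + 1)"
    assume "f h \<noteq> Re (cinner h z)"
    then have d: "d \<noteq> 0" by (simp add: d_def)
    have "J (z + t *\<^sub>R h) = J z + t\<^sup>2 * (norm h)\<^sup>2 - 2 * t * d"
      using Re_cinner_commute[of z h]
      by (simp add: J_def power2_norm_add add scale cinner_scaleR_right power_mult_distrib
          d_def algebra_simps)
    then have *: "2 * (t * d) \<le> t\<^sup>2 * (norm h)\<^sup>2"
      using J_min[of "z + t *\<^sub>R h"] by simp
    have pos: "(norm h)\<^sup>2 + 1 > 0"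
      by (simp add: add_nonneg_pos)
    have "t \<noteq> 0"
      using d pos by (simp add: t_def)
    have td: "t * d = t\<^sup>2 * ((norm h)\<^sup>2 + 1)"
      using pos by (simp add: t_def power2_eq_square)
    have "2 * (t * d) = t\<^sup>2 * (norm h)\<^sup>2 + (t\<^sup>2 * (norm h)\<^sup>2 + 2 * t\<^sup>2)"
      unfolding td by (simp add: distrib_left)
    moreover have "0 < t\<^sup>2 * (norm h)\<^sup>2 + 2 * t\<^sup>2"
      using \<open>t \<noteq> 0\<close> by (intro add_nonneg_pos) auto
    ultimately show False
      using * by (metis add_less_same_cancel1 less_add_same_cancel1 linorder_not_le)
  qed
  then show ?thesis using that by blast
qed

section \<open>Existence and boundedness of adjoints\<close>

lemma cinner_cadjoint:
  assumes "bounded_clinear f"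
  shows "cinner (f x) y = cinner x (cadjoint f y)"
proof -
  have f: "bounded_linear f" and scale: "f (c *\<^sub>C x) = c *\<^sub>C f x" for c x
    using assms by (auto simp: bounded_clinear_def)
  have "\<exists>z. \<forall>x. cinner (f x) y = cinner x z" for y
  proof -
    have "bounded_linear (\<lambda>x. Re (cinner (f x) y))"
      by (rule bounded_linear_compose[OF bounded_linear_Re_cinner_left f])
    then obtain z where z: "\<And>x. Re (cinner (f x) y) = Re (cinner x z)"
      using real_riesz_representation by blast
    \<comment> \<open>Multiplying the argument by the imaginary unit turns the identity of real
      parts into one of imaginary parts; this uses complex linearity of \<open>f\<close>.\<close>
    have "Im (cinner (f x) y) = Im (cinner x z)" for x
      using z[of "\<i> *\<^sub>C x"] by (simp add: scale cinner_scaleC_left)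
    then show ?thesis
      using z by (auto simp: complex_eq_iff)
  qed
  then have "\<exists>g. \<forall>x y. cinner (f x) y = cinner x (g y)"
    by metis
  then have "\<forall>x y. cinner (f x) y = cinner x (cadjoint f y)"
    unfolding cadjoint_def by (rule someI_ex)
  then show ?thesis by blast
qed

lemma eq_if_cinner_eq:
  assumes "\<And>x. cinner x y = cinner x z"
  shows "y = z"
proof -
  have "(norm (y - z))\<^sup>2 = Re (cinner (y - z) (y + - z))"
    by (simp add: power2_norm_eq_Re_cinner)
  also have "\<dots> = 0"
    by (simp only: cinner_add_right cinner_minus_right assms) simp
  finally show ?thesis by simp
qed

text \<open>Test the adjoint relation with \<open>cadjoint f y\<close> itself, apply Cauchy-Schwarz
  and cancel one factor of its norm.\<close>

lemma norm_cadjoint_le: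
  assumes "bounded_clinear f"
  shows "norm (cadjoint f y) \<le> onorm f * norm y"
proof (cases "cadjoint f y = 0")
  case True
  then show ?thesis
    using assms by (simp add: bounded_clinear_def onorm_pos_le)
next
  case False
  have f: "bounded_linear f" using assms by (simp add: bounded_clinear_def)
  let ?z = "cadjoint f y"
  have "(norm ?z)\<^sup>2 = Re (cinner (f ?z) y)"
    by (simp add: power2_norm_eq_Re_cinner cinner_cadjoint[OF assms])
  also have "\<dots> \<le> norm (f ?z) * norm y"
    by (rule Re_cinner_le_norm)
  also have "\<dots> \<le> onorm f * norm ?z * norm y"
    by (intro mult_right_mono onorm f) auto
  finally have "norm ?z * norm ?z \<le> norm ?z * (onorm f * norm y)"
    by (simp add: power2_eq_square mult_ac)
  then show ?thesis
    using False by simp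
qed

lemma bounded_linear_cadjoint:
  assumes "bounded_clinear f"
  shows "bounded_linear (cadjoint f)"
proof (rule bounded_linear_intro)
  show "cadjoint f (x + y) = cadjoint f x + cadjoint f y" for x y
    by (rule eq_if_cinner_eq) (simp add: cinner_add_right flip: cinner_cadjoint[OF assms])
  show "cadjoint f (r *\<^sub>R x) = r *\<^sub>R cadjoint f x" for r x
    by (rule eq_if_cinner_eq) (simp add: cinner_scaleR_right flip: cinner_cadjoint[OF assms])
  show "norm (cadjoint f x) \<le> norm x * onorm f" for x
    using norm_cadjoint_le[OF assms, of x] by (simp add: mult.commute)
qed

lemma onorm_cadjoint_le:
  assumes "bounded_clinear f"
  shows "onorm (cadjoint f) \<le> onorm f"
  using assms norm_cadjoint_le by (auto intro!: onorm_bound simp: bounded_clinear_def onorm_pos_le)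

section \<open>Powers of operators\<close>

lemma bounded_linear_funpow:
  fixes f :: "'a::real_normed_vector \<Rightarrow> 'a"
  assumes "bounded_linear f"
  shows "bounded_linear (f ^^ n)"
proof (induction n)
  case 0
  show ?case by (simp add: id_def bounded_linear_ident)
next
  case (Suc n)
  then show ?case
    using bounded_linear_compose[OF assms Suc] by (simp add: o_def)
qed

text \<open>Half of the C*-identity, from Cauchy-Schwarz applied to \<open>x\<close> and
  \<open>g (f x)\<close>. Stating adjointness as a relation lets it serve both for the operator sum
  and for self-adjoint powers.\<close>

lemma onorm_power2_le_onorm_compose:
  assumes f: "bounded_linear f" and g: "bounded_linear g"
    and adj: "\<And>x y. cinner (f x) y = cinner x (g y)"
  shows "(onorm f)\<^sup>2 \<le> onorm (g \<circ> f)"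
proof -
  have gf: "bounded_linear (g \<circ> f)"
    using bounded_linear_compose[OF g f] by (simp add: o_def)
  have "norm (f x) \<le> sqrt (onorm (g \<circ> f)) * norm x" for x
  proof -
    have "(norm (f x))\<^sup>2 = Re (cinner x ((g \<circ> f) x))"
      by (simp add: power2_norm_eq_Re_cinner adj)
    also have "\<dots> \<le> norm x * norm ((g \<circ> f) x)"
      by (rule Re_cinner_le_norm)
    also have "\<dots> \<le> norm x * (onorm (g \<circ> f) * norm x)"
      by (intro mult_left_mono onorm gf) auto
    also have "\<dots> = (sqrt (onorm (g \<circ> f)) * norm x)\<^sup>2"
      using onorm_pos_le[OF gf] by (simp add: power_mult_distrib power2_eq_square mult_ac)
    finally show ?thesis
      by (rule power2_le_imp_le) (simp add: onorm_pos_le[OF gf])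
  qed
  then have "onorm f \<le> sqrt (onorm (g \<circ> f))"
    by (intro onorm_bound) (auto simp: onorm_pos_le[OF gf])
  then show ?thesis
    using onorm_pos_le[OF f] onorm_pos_le[OF gf] real_le_rsqrt by (metis real_sqrt_pow2 power_mono)
qed

text \<open>Powers of a self-adjoint operator are self-adjoint, so the preceding inequality applies
  with \<open>g = f\<close> to each of them. Every application doubles the exponent, hence the
  powers of two.\<close>

lemma onorm_self_adjoint_power_le:
  assumes f: "bounded_linear f"
    and adj: "\<And>x y. cinner (f x) y = cinner x (f y)"
  shows "onorm f ^ (2 ^ k) \<le> onorm (f ^^ (2 ^ k))"
proof (induction k)
  case 0
  show ?case by simp
next
  case (Suc k)
  have adj': "cinner ((f ^^ n) x) y = cinner x ((f ^^ n) y)" for n x y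
    by (induction n arbitrary: x y) (simp_all add: adj funpow_swap1)
  have "onorm f ^ (2 ^ Suc k) = (onorm f ^ (2 ^ k))\<^sup>2"
    by (simp add: mult.commute flip: power_mult)
  also have "\<dots> \<le> (onorm (f ^^ (2 ^ k)))\<^sup>2"
    by (intro power_mono Suc) (simp add: onorm_pos_le[OF f])
  also have "\<dots> \<le> onorm (f ^^ (2 ^ k) \<circ> f ^^ (2 ^ k))"
    by (intro onorm_power2_le_onorm_compose bounded_linear_funpow f adj')
  also have "\<dots> = onorm (f ^^ (2 ^ Suc k))"
    by (simp add: mult_2 flip: funpow_add)
  finally show ?case .
qed

section \<open>Alternating words\<close>

text \<open>Exchanging the two families in the recursive call encodes the parity of the
  position.\<close>

fun alt_word :: "('n \<Rightarrow> 'a \<Rightarrow> 'a) \<Rightarrow> ('n \<Rightarrow> 'a \<Rightarrow> 'a) \<Rightarrow> 'n list \<Rightarrow> 'a \<Rightarrow> 'a" where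
  "alt_word F G [] = id"
| "alt_word F G (i # w) = F i \<circ> alt_word G F w"

fun alt_pow :: "('a \<Rightarrow> 'a) \<Rightarrow> ('a \<Rightarrow> 'a) \<Rightarrow> nat \<Rightarrow> 'a \<Rightarrow> 'a" where
  "alt_pow f g 0 = id"
| "alt_pow f g (Suc n) = f \<circ> alt_pow g f n"

lemma alt_pow_double: "alt_pow f g (2 * n) = (f \<circ> g) ^^ n"
  by (induction n) (simp_all add: o_assoc)

lemma sum_lists_Suc:
  fixes h :: "'n::finite list \<Rightarrow> 'b::comm_monoid_add"
  shows "(\<Sum>w | length w = Suc n. h w) = (\<Sum>i\<in>UNIV. \<Sum>w | length w = n. h (i # w))"
proof -
  have "{w :: 'n list. length w = Suc n} = (\<lambda>(i, w). i # w) ` (UNIV \<times> {w. length w = n})"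
    by (auto simp: length_Suc_conv image_iff)
  then show ?thesis
    by (simp add: sum.reindex inj_on_def case_prod_beta sum.cartesian_product)
qed

lemma finite_lists_length: "finite {w :: 'n::finite list. length w = n}"
  using finite_lists_length_eq[of "UNIV :: 'n set" n] by simp

text \<open>Noncommutative expansion of the product: by linearity the outermost \<open>F i\<close>
  passes through the sum over the shorter words, which start with \<open>G\<close>.\<close>

lemma alt_pow_sum_eq_sum_alt_word:
  fixes F G :: "'n::finite \<Rightarrow> 'a::real_normed_vector \<Rightarrow> 'a"
  assumes "\<And>i. bounded_linear (F i)" "\<And>i. bounded_linear (G i)"
  shows "alt_pow (\<lambda>x. \<Sum>i\<in>UNIV. F i x) (\<lambda>x. \<Sum>i\<in>UNIV. G i x) n x
    = (\<Sum>w | length w = n. alt_word F G w x)"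
  using assms
proof (induction n arbitrary: F G)
  case 0
  show ?case by simp
next
  case (Suc n)
  have lin: "F i (\<Sum>w | length w = n. h w) = (\<Sum>w | length w = n. F i (h w))" for i h
    by (rule linear_sum) (use Suc.prems in \<open>auto intro: bounded_linear.linear\<close>)
  show ?case
    by (simp add: Suc.IH[OF Suc.prems(2,1)] lin sum_lists_Suc)
qed

lemma bounded_linear_alt_word:
  fixes F G :: "'n \<Rightarrow> 'a::real_normed_vector \<Rightarrow> 'a"
  assumes "\<And>i. bounded_linear (F i)" "\<And>i. bounded_linear (G i)"
  shows "bounded_linear (alt_word F G w)"
  using assms
proof (induction w arbitrary: F G)
  case Nil
  show ?case by (simp add: id_def bounded_linear_ident)
next
  case (Cons i w)
  show ?case
    using bounded_linear_compose[OF Cons.prems(1) Cons.IH[OF Cons.prems(2,1)]]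
    by (simp add: o_def)
qed

section \<open>Norm bounds for a single word\<close>

fun pair_bound :: "('n \<Rightarrow> real) \<Rightarrow> ('n \<Rightarrow> 'n \<Rightarrow> real) \<Rightarrow> 'n list \<Rightarrow> real" where
  "pair_bound a \<alpha> [] = 1"
| "pair_bound a \<alpha> [i] = a i"
| "pair_bound a \<alpha> (i # j # w) = (\<alpha> i j)\<^sup>2 * a i * a j * pair_bound a \<alpha> w"

text \<open>The contribution of one path to an entry of a matrix power; a word of
  \<open>n + 1\<close> letters has \<open>n\<close> links.\<close>

fun path_weight :: "('n \<Rightarrow> 'n \<Rightarrow> real) \<Rightarrow> 'n list \<Rightarrow> real" where
  "path_weight \<alpha> [] = 1"
| "path_weight \<alpha> [i] = 1"
| "path_weight \<alpha> (i # j # w) = \<alpha> i j * path_weight \<alpha> (j # w)"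

lemma pair_bound_nonneg: "(\<And>i. 0 \<le> a i) \<Longrightarrow> 0 \<le> pair_bound a \<alpha> w"
  by (induction a \<alpha> w rule: pair_bound.induct) auto

lemma path_weight_nonneg: "(\<And>i j. 0 \<le> \<alpha> i j) \<Longrightarrow> 0 \<le> path_weight \<alpha> w"
  by (induction \<alpha> w rule: path_weight.induct) auto

text \<open>The two factors \<open>pair_bound a \<alpha> (i # w)\<close> and \<open>a i * pair_bound a \<alpha> w\<close> correspond to the
  two ways of grouping adjacent letters.\<close>

lemma pair_bound_mult_shifted:
  "pair_bound a \<alpha> (i # w) * (a i * pair_bound a \<alpha> w)
    = (prod_list (map a (i # w)) * path_weight \<alpha> (i # w))\<^sup>2"
proof (induction w arbitrary: i)
  case Nil
  show ?case by (simp add: power2_eq_square)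
next
  case (Cons j w)
  \<comment> \<open>Prefixing \<open>i\<close> exchanges the roles of the two groupings: one gains
    the pair \<open>i\<close>, \<open>j\<close>, the other the single letter
    \<open>i\<close>.\<close>
  have "pair_bound a \<alpha> (i # j # w) * (a i * pair_bound a \<alpha> (j # w))
      = (\<alpha> i j * a i)\<^sup>2 * (pair_bound a \<alpha> (j # w) * (a j * pair_bound a \<alpha> w))"
    by (simp add: power2_eq_square)
  also have "\<dots> = (prod_list (map a (i # j # w)) * path_weight \<alpha> (i # j # w))\<^sup>2"
    unfolding Cons.IH by (simp add: power2_eq_square)
  finally show ?case .
qed

lemma prod_list_map_le_power:
  fixes a :: "'n \<Rightarrow> real"
  assumes "\<And>i. 0 \<le> a i" "\<And>i. a i \<le> M"
  shows "0 \<le> prod_list (map a w) \<and> prod_list (map a w) \<le> M ^ length w"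
proof (induction w)
  case (Cons i w)
  then show ?case
    using assms order_trans[OF assms] by (auto intro!: mult_mono)
qed simp

lemma onorm_compose': "bounded_linear f \<Longrightarrow> bounded_linear g \<Longrightarrow> onorm f \<le> b \<Longrightarrow> onorm g \<le> c
    \<Longrightarrow> onorm (f \<circ> g) \<le> b * c"
  by (rule order_trans[OF onorm_compose]) (auto intro!: mult_mono intro: onorm_pos_le order_trans)

text \<open>Two letters at a time: after two exchanges the families are back in order, so they stay
  fixed in the induction. A last unpaired letter is estimated by its own norm.\<close>

lemma onorm_alt_word_le_pair_bound:
  fixes F G :: "'n \<Rightarrow> 'a::real_normed_vector \<Rightarrow> 'a"
  assumes "\<And>i. bounded_linear (F i)" "\<And>i. bounded_linear (G i)"
    and "\<And>i. onorm (F i) \<le> a i"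
    and "\<And>i j. onorm (F i \<circ> G j) \<le> (\<alpha> i j)\<^sup>2 * a i * a j"
  shows "onorm (alt_word F G w) \<le> pair_bound a \<alpha> w"
proof (induction w rule: induct_list012)
  case 1
  show ?case by (simp add: id_def onorm_id_le)
next
  case (2 i)
  show ?case using assms(3) by simp
next
  case (3 i j w)
  have "bounded_linear (F i \<circ> G j)"
    using bounded_linear_compose[OF assms(1,2)] by (simp add: o_def)
  then have "onorm (F i \<circ> G j \<circ> alt_word F G w) \<le> pair_bound a \<alpha> (i # j # w)"
    unfolding pair_bound.simps
    by (intro onorm_compose' bounded_linear_alt_word assms(1,2,4) 3)
  then show ?case by (simp only: alt_word.simps o_assoc)
qed

text \<open>Each link lies in exactly one of the two groupings and contributes a squared entry
  there, so the product of the two bounds is a perfect square.\<close>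

lemma onorm_alt_word_le_path_weight:
  fixes F G :: "'n \<Rightarrow> 'a::real_normed_vector \<Rightarrow> 'a"
  assumes F: "\<And>i. bounded_linear (F i)" and G: "\<And>i. bounded_linear (G i)"
    and Fa: "\<And>i. onorm (F i) \<le> a i" and Ga: "\<And>i. onorm (G i) \<le> a i"
    and FG: "\<And>i j. onorm (F i \<circ> G j) \<le> (\<alpha> i j)\<^sup>2 * a i * a j"
    and GF: "\<And>i j. onorm (G i \<circ> F j) \<le> (\<alpha> i j)\<^sup>2 * a i * a j"
    and \<alpha>: "\<And>i j. 0 \<le> \<alpha> i j" and M: "\<And>i. a i \<le> M"
  shows "onorm (alt_word F G (i # w)) \<le> M ^ Suc (length w) * path_weight \<alpha> (i # w)"
proof -
  have a: "0 \<le> a i" for i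
    using onorm_pos_le[OF F] Fa order_trans by blast
  have prod: "0 \<le> prod_list (map a (i # w)) \<and> prod_list (map a (i # w)) \<le> M ^ length (i # w)"
    by (intro prod_list_map_le_power a M)
  have path: "0 \<le> path_weight \<alpha> (i # w)"
    by (intro path_weight_nonneg \<alpha>)
  let ?N = "onorm (alt_word F G (i # w))"
  let ?R = "prod_list (map a (i # w)) * path_weight \<alpha> (i # w)"
  have "?N \<le> pair_bound a \<alpha> (i # w)"
    by (intro onorm_alt_word_le_pair_bound F G Fa FG)
  \<comment> \<open>Shifted grouping: the tail \<open>w\<close> starts with \<open>G\<close>, so its
    pairs are controlled by \<open>GF\<close>.\<close>
  moreover have "?N \<le> a i * pair_bound a \<alpha> w"
    unfolding alt_word.simps
    by (intro onorm_compose' onorm_alt_word_le_pair_bound bounded_linear_alt_word F G Fa Ga GF)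
  moreover have "0 \<le> ?N"
    by (intro onorm_pos_le bounded_linear_alt_word F G)
  ultimately have "?N\<^sup>2 \<le> ?R\<^sup>2"
    unfolding pair_bound_mult_shifted[symmetric] power2_eq_square[of ?N]
    by (intro mult_mono) (auto simp: pair_bound_nonneg a)
  then have "?N \<le> ?R"
    by (rule power2_le_imp_le[OF _ mult_nonneg_nonneg[OF conjunct1[OF prod] path]])
  also have "\<dots> \<le> M ^ Suc (length w) * path_weight \<alpha> (i # w)"
    using prod path by (intro mult_right_mono) auto
  finally show ?thesis .
qed

section \<open>Summation over words and removal of the constant\<close>

lemma sum_path_weight:
  fixes A :: "real ^ 'n ^ 'n"
  shows "(\<Sum>w | length w = n. path_weight (\<lambda>i j. A $ i $ j) (i # w)) = (((*v) A) ^^ n) 1 $ i"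
proof (induction n arbitrary: i)
  case 0
  show ?case by simp
next
  case (Suc n)
  \<comment> \<open>Summing over the second letter is one multiplication by \<open>A\<close>; the
    recursion ends at the all-ones vector \<open>1\<close>.\<close>
  show ?case
    by (simp add: sum_lists_Suc Suc.IH matrix_vector_mult_def flip: sum_distrib_left)
qed

lemma norm_funpow_le:
  fixes f :: "'a::real_normed_vector \<Rightarrow> 'a"
  assumes "bounded_linear f"
  shows "norm ((f ^^ n) x) \<le> onorm f ^ n * norm x"
proof (induction n)
  case (Suc n)
  have "norm ((f ^^ Suc n) x) \<le> onorm f * norm ((f ^^ n) x)"
    by (simp add: onorm[OF assms])
  also have "\<dots> \<le> onorm f * (onorm f ^ n * norm x)"
    by (intro mult_left_mono Suc onorm_pos_le assms)
  finally show ?case by (simp add: mult.assoc)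
qed simp

text \<open>The factor \<open>CARD('n)\<close> counts the choices of the first letter, and
  \<open>norm 1\<close> comes from the all-ones vector. Neither depends on \<open>n\<close>.\<close>

lemma onorm_alt_pow_le:
  fixes F G :: "'n::finite \<Rightarrow> 'a::real_normed_vector \<Rightarrow> 'a" and A :: "real ^ 'n ^ 'n"
  assumes F: "\<And>i. bounded_linear (F i)" and G: "\<And>i. bounded_linear (G i)"
    and Fa: "\<And>i. onorm (F i) \<le> a i" and Ga: "\<And>i. onorm (G i) \<le> a i"
    and FG: "\<And>i j. onorm (F i \<circ> G j) \<le> (A $ i $ j)\<^sup>2 * a i * a j"
    and GF: "\<And>i j. onorm (G i \<circ> F j) \<le> (A $ i $ j)\<^sup>2 * a i * a j"
    and A: "\<And>i j. 0 \<le> A $ i $ j" and M: "\<And>i. a i \<le> M"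
  shows "onorm (alt_pow (\<lambda>x. \<Sum>i\<in>UNIV. F i x) (\<lambda>x. \<Sum>i\<in>UNIV. G i x) (Suc n))
    \<le> real CARD('n) * norm (1 :: real ^ 'n) * M ^ Suc n * onorm ((*v) A) ^ n"
proof -
  have bl: "bounded_linear ((*v) A)"
    by (simp add: matrix_vector_mul_bounded_linear)
  have M0: "0 \<le> M"
    using order_trans[OF onorm_pos_le[OF F] order_trans[OF Fa M]] .
  let ?W = "\<lambda>i w. alt_word F G (i # w)"
  have W: "bounded_linear (?W i w)" for i w
    by (intro bounded_linear_alt_word F G)
  have "onorm (alt_pow (\<lambda>x. \<Sum>i\<in>UNIV. F i x) (\<lambda>x. \<Sum>i\<in>UNIV. G i x) (Suc n))
      = onorm (\<lambda>x. \<Sum>i\<in>UNIV. \<Sum>w | length w = n. ?W i w x)"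
    by (intro arg_cong[where f = onorm] ext)
       (simp only: alt_pow_sum_eq_sum_alt_word[OF F G] sum_lists_Suc)
  also have "\<dots> \<le> (\<Sum>i\<in>UNIV. \<Sum>w | length w = n. onorm (?W i w))"
    by (intro order_trans[OF onorm_sum] sum_mono bounded_linear_sum W finite finite_lists_length
        order_refl)
  also have "\<dots> \<le> (\<Sum>i\<in>UNIV. \<Sum>w | length w = n.
      M ^ Suc n * path_weight (\<lambda>i j. A $ i $ j) (i # w))"
  proof (intro sum_mono)
    fix i and w :: "'n list" assume "w \<in> {w. length w = n}"
    then show "onorm (?W i w) \<le> M ^ Suc n * path_weight (\<lambda>i j. A $ i $ j) (i # w)"
      using onorm_alt_word_le_path_weight[where \<alpha> = "\<lambda>i j. A $ i $ j", OF F G Fa Ga FG GF A M]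
      by auto
  qed
  also have "\<dots> = M ^ Suc n * (\<Sum>i\<in>UNIV. (((*v) A) ^^ n) 1 $ i)"
    by (simp add: sum_path_weight flip: sum_distrib_left)
  also have "\<dots> \<le> M ^ Suc n * (\<Sum>i\<in>(UNIV :: 'n set). onorm ((*v) A) ^ n * norm (1 :: real ^ 'n))"
  proof (intro mult_left_mono sum_mono)
    fix i
    have "(((*v) A) ^^ n) 1 $ i \<le> norm ((((*v) A) ^^ n) 1)"
      by (meson abs_le_D1 component_le_norm_cart)
    also have "\<dots> \<le> onorm ((*v) A) ^ n * norm (1 :: real ^ 'n)"
      by (rule norm_funpow_le[OF bl])
    finally show "(((*v) A) ^^ n) 1 $ i \<le> onorm ((*v) A) ^ n * norm (1 :: real ^ 'n)" .
  qed (use M0 in simp)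
  also have "\<dots> = real CARD('n) * norm (1 :: real ^ 'n) * M ^ Suc n * onorm ((*v) A) ^ n"
    by simp
  finally show ?thesis .
qed

text \<open>The ratio of \<open>s\<close> to \<open>M * A\<close> has bounded powers along an
  unbounded sequence of exponents, so it cannot exceed 1.\<close>

lemma le_mult_if_power_bound:
  fixes s M A D :: real
  assumes nonneg: "0 \<le> s" "0 \<le> M" "0 \<le> A"
    and bound: "\<And>k. s ^ (2 * 2 ^ k) \<le> D * M ^ (2 * 2 ^ k) * A ^ (2 * 2 ^ k - 1)"
  shows "s \<le> M * A"
proof (cases "M * A = 0")
  \<comment> \<open>Here the ratio is undefined, but the bound at \<open>k = 0\<close> reads
    \<open>s^2 \<le> D * M^2 * A = 0\<close>.\<close>
  case True
  then have "s\<^sup>2 \<le> 0"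
    using bound[of 0] by auto
  then show ?thesis using nonneg by simp
next
  case False
  then have pos: "0 < M" "0 < A"
    using nonneg by auto
  define r where "r = s / (M * A)"
  have r_le: "r ^ (2 * 2 ^ k) \<le> D / A" for k
  proof -
    \<comment> \<open>There is one link fewer than letters; the missing factor \<open>A\<close> is
      moved into the constant \<open>D / A\<close>.\<close>
    have "A * A ^ (2 * 2 ^ k - 1) = A ^ (2 * 2 ^ k)"
      by (subst power_Suc[symmetric]) simp
    then have "D / A * (M * A) ^ (2 * 2 ^ k) = D * M ^ (2 * 2 ^ k) * A ^ (2 * 2 ^ k - 1)"
      using pos by (simp add: power_mult_distrib field_simps)
    then have "s ^ (2 * 2 ^ k) \<le> D / A * (M * A) ^ (2 * 2 ^ k)"
      using bound[of k] by simp
    then show ?thesis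
      using pos by (simp add: r_def power_divide pos_divide_le_eq)
  qed
  have "r \<le> 1"
  proof (rule ccontr)
    assume "\<not> r \<le> 1"
    then have "1 < r" by simp
    then obtain n where n: "D / A < r ^ n"
      using real_arch_pow by blast
    have "n \<le> 2 * 2 ^ n"
      using less_exp[of n] by linarith
    then have "r ^ n \<le> r ^ (2 * 2 ^ n)"
      using \<open>1 < r\<close> by (intro power_increasing) auto
    then show False
      using n r_le[of n] by linarith
  qed
  then show ?thesis
    using pos by (simp add: r_def pos_divide_le_eq)
qed

theorem mainTheorem2:
  fixes T :: "'n::finite \<Rightarrow> 'h::chilbert_space \<Rightarrow> 'h"
    and \<alpha> :: "real ^ 'n ^ 'n"
  assumes "separable_space (euclidean :: 'h topology)"
    and "CARD('n) \<ge> 2"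
    and "\<And>j. bounded_clinear (T j)"
    and "transpose \<alpha> = \<alpha>"
    and "\<And>i j. \<alpha> $ i $ j \<in> {0..1}"
    and "\<And>i j. onorm (T i \<circ> cadjoint (T j)) \<le> (\<alpha> $ i $ j)\<^sup>2 * onorm (T i) * onorm (T j)"
    and "\<And>i j. onorm (cadjoint (T i) \<circ> T j) \<le> (\<alpha> $ i $ j)\<^sup>2 * onorm (T i) * onorm (T j)"
  shows "onorm (\<lambda>x. \<Sum>j\<in>UNIV. T j x) \<le> onorm (\<lambda>v. \<alpha> *v v) * (SUP j. onorm (T j))"
proof -
  define M where "M = (SUP j. onorm (T j))"
  define S where "S = (\<lambda>x. \<Sum>j\<in>UNIV. T j x)"
  define S' where "S' = (\<lambda>x. \<Sum>j\<in>UNIV. cadjoint (T j) x)"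
  have T: "bounded_linear (T j)" for j
    using assms(3) by (simp add: bounded_clinear_def)
  have T': "bounded_linear (cadjoint (T j))" for j
    by (intro bounded_linear_cadjoint assms(3))
  have S: "bounded_linear S" and S': "bounded_linear S'"
    unfolding S_def S'_def by (intro bounded_linear_sum T T')+
  have M: "onorm (T j) \<le> M" for j
    unfolding M_def by (intro cSUP_upper) auto
  have M0: "0 \<le> M"
    using order_trans[OF onorm_pos_le[OF T] M] .
  have adj: "cinner (S x) y = cinner x (S' y)" for x y
    unfolding S_def S'_def
    by (simp add: cinner_sum_left cinner_sum_right cinner_cadjoint[OF assms(3)])
  have adj': "cinner (S' x) y = cinner x (S y)" for x y
    by (metis adj cinner_commute)
  have P: "bounded_linear (S' \<circ> S)"
    using bounded_linear_compose[OF S' S] by (simp add: o_def)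
  have "onorm S ^ (2 * 2 ^ k) \<le> real CARD('n) * norm (1 :: real ^ 'n) * M ^ (2 * 2 ^ k)
      * onorm ((*v) \<alpha>) ^ (2 * 2 ^ k - 1)" for k
  proof -
    have "onorm S ^ (2 * 2 ^ k) = ((onorm S)\<^sup>2) ^ (2 ^ k)"
      by (simp add: power_mult)
    also have "\<dots> \<le> onorm (S' \<circ> S) ^ (2 ^ k)"
      by (intro power_mono onorm_power2_le_onorm_compose S S' adj) simp
    also have "\<dots> \<le> onorm ((S' \<circ> S) ^^ (2 ^ k))"
      by (intro onorm_self_adjoint_power_le P) (simp add: adj adj')
    \<comment> \<open>Each factor \<open>S' \<circ> S\<close> supplies two letters; the successor
      form separates the number of letters from the number of links.\<close>
    also have "\<dots> = onorm (alt_pow S' S (Suc (2 * 2 ^ k - 1)))"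
      by (simp flip: alt_pow_double del: alt_pow.simps)
    also have "\<dots> \<le> real CARD('n) * norm (1 :: real ^ 'n) * M ^ Suc (2 * 2 ^ k - 1)
        * onorm ((*v) \<alpha>) ^ (2 * 2 ^ k - 1)"
      unfolding S_def S'_def
    \<comment> \<open>The words start with an adjoint. One function \<open>a\<close> bounds both
      families, since passing to the adjoint does not increase the norm.\<close>
    proof (rule onorm_alt_pow_le[where a = "\<lambda>i. onorm (T i)"])
      show "0 \<le> \<alpha> $ i $ j" for i j
        using assms(5)[of i j] by simp
    qed (rule T T' onorm_cadjoint_le[OF assms(3)] order_refl assms(6,7) M)+
    finally show ?thesis
      by (simp del: power_Suc)
  qed
  then have "onorm S \<le> M * onorm ((*v) \<alpha>)"
    by (rule le_mult_if_power_bound[OF onorm_pos_le[OF S] M0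
          onorm_pos_le[OF matrix_vector_mul_bounded_linear]])
  then show ?thesis
    by (simp add: M_def S_def mult.commute)
qed

end
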